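(* Let $C=F/I$ be a non-zero regular monomial cyclic right module and consider the corresponding reduced adjacency matrix $\bar A_I$. Then $C$ is finite-dimensional (over $\mathbb{K}$) if and only if $\bar A_I$ is a nilpotent matrix.
   Context: Let $\mathbb{K}$ be any field, $X=\{x_1,\ldots,x_n\}$ a finite (non-empty) set of variables, $W=X^*$ the free monoid of words over $X$, and $F=\mathbb{K}\langle X\rangle$ the free associative algebra. A monomial right ideal of $F$ is a right ideal generated by a (possibly infinite) set of words; $\mathcal{MI}$ denotes the set of all of them. A monomial cyclic right module is a right module $C=F/I$ with $I\in\mathcal{MI}$. For each variable $x_i$, $T_{x_i}:\mathcal{MI}\to\mathcal{MI}$ is $T_{x_i}(I)=(I:_Rx_i)=\{f\in F\mid x_if\in I\}$. The orbit $\mathcal{O}_I$ is the minimal subset of $\mathcal{MI}$ containing $I$ with $T_{x_i}(\mathcal{O}_I)\subset\mathcal{O}_I$ for all $i$. The ideal $I$, and the module $F/I$, is called regular if $\mathcal{O}_I$ is finite. For $I$ regular with $\mathcal{O}_I=\{I_1,\ldots,I_r\}$, $I_1=I$, the adjacency matrix is $A_I=(a_{kl})\in\mathbb{Z}^{r\times r}$ with $a_{kl}=\#\{1\le i\le n\mid T_{x_i}(I_k)=I_l\}$. For $I\neq\langle1\rangle$, the reduced orbit is $\bar{\mathcal{O}}_I=\mathcal{O}_I\setminus\{\langle1\rangle\}$, and the reduced adjacency matrix $\bar A_I$ is the square matrix obtained from $A_I$ by deleting the row and the column corresponding to the ideal $\langle1\rangle$, i.e. the submatrix of $A_I$ indexed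 by $\bar{\mathcal{O}}_I$ (if $I=0$, then $\langle 1\rangle\notin\mathcal{O}_I$ and nothing is deleted). *)

theory Defs
  imports
    "HOL-Library.Poly_Mapping"
    "Jordan_Normal_Form.DL_Submatrix"
    "Jordan_Normal_Form.VS_Connect"
    "HOL-Algebra.AbelCoset"
begin

hide_const (open) Multiset.mult Polynomial.smult

section \<open>The free associative algebra\<close>

text \<open>
  The free monoid over the alphabet \<open>'x\<close>, written additively: the convolution product of
  \<^theory>\<open>HOL-Library.Poly_Mapping\<close> expects an additive (not necessarily commutative) monoid of
  exponents.  Hence \<open>+\<close> is concatenation and \<open>0\<close> is the empty word.
\<close>

datatype 'x word = Word (letters: "'x list")

instantiation word :: (type) monoid_add
begin

definition zero_word :: "'a word"
  where "0 = Word []"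

definition plus_word :: "'a word \<Rightarrow> 'a word \<Rightarrow> 'a word"
  where "u + v = Word (letters u @ letters v)"

instance
  by standard (simp_all add: zero_word_def plus_word_def)

end

type_synonym ('k, 'x) free_algebra = "'x word \<Rightarrow>\<^sub>0 'k"

definition word_monomial :: "'x word \<Rightarrow> ('k::field, 'x) free_algebra"
  where "word_monomial w = Poly_Mapping.single w 1"

definition var :: "'x \<Rightarrow> ('k::field, 'x) free_algebra"
  where "var x = word_monomial (Word [x])"

definition free_algebra_module :: "('k::field, ('k, 'x) free_algebra) module"
  where "free_algebra_module =
    \<lparr>carrier = UNIV, mult = (*), one = 1, zero = 0, add = (+),
     smult = (\<lambda>c f. Poly_Mapping.single 0 c * f)\<rparr>"


section \<open>Monomial right ideals and cyclic modules\<close>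

definition right_ideal :: "('k::field, 'x) free_algebra set \<Rightarrow> bool"
  where "right_ideal I \<longleftrightarrow>
    0 \<in> I \<and> (\<forall>f\<in>I. \<forall>g\<in>I. f + g \<in> I) \<and> (\<forall>f\<in>I. \<forall>g. f * g \<in> I)"

definition right_ideal_gen :: "('k::field, 'x) free_algebra set \<Rightarrow> ('k, 'x) free_algebra set"
  where "right_ideal_gen S = \<Inter> {J. right_ideal J \<and> S \<subseteq> J}"

definition monomial_right_ideals :: "('k::field, 'x) free_algebra set set"
  where "monomial_right_ideals = {right_ideal_gen (word_monomial ` G) | G. True}"

text \<open>
  The quotient \<open>F/I\<close> as a \<open>K\<close>-module; its elements are the cosets \<open>f + I\<close>.  There is no product
  on \<open>F/I\<close> for a right ideal \<open>I\<close>, so the ring fields \<open>mult\<close> and \<open>one\<close> of the record,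
  which the module axioms do not mention, are left unspecified.
\<close>

definition cyclic_module ::
    "('k::field, 'x) free_algebra set \<Rightarrow> ('k, ('k, 'x) free_algebra set) module"
  where "cyclic_module I =
    \<lparr>carrier = a_rcosets\<^bsub>free_algebra_module\<^esub> I,
     mult = undefined, one = undefined,
     zero = I,
     add = (\<lambda>X Y. X <+>\<^bsub>free_algebra_module\<^esub> Y),
     smult = (\<lambda>c X. \<Union>f\<in>X. I +>\<^bsub>free_algebra_module\<^esub> (c \<odot>\<^bsub>free_algebra_module\<^esub> f))\<rparr>"


section \<open>Orbits and adjacency matrices\<close>

definition transition :: "'x \<Rightarrow> ('k::field, 'x) free_algebra set \<Rightarrow> ('k, 'x) free_algebra set"
  where "transition x I = {f. var x * f \<in> I}"

inductive_set orbit :: "('k::field, 'x) free_algebra set \<Rightarrow> ('k, 'x) free_algebra set set"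
  for I where
  base: "I \<in> orbit I"
| step: "J \<in> orbit I \<Longrightarrow> transition x J \<in> orbit I"

definition regular :: "('k::field, 'x) free_algebra set \<Rightarrow> bool"
  where "regular I \<longleftrightarrow> finite (orbit I)"

text \<open>
  The adjacency matrix depends on an enumeration \<open>I\<^sub>1, \<dots>, I\<^sub>r\<close> of the orbit with
  \<open>I\<^sub>1 = I\<close>, given here as a list (so positions are counted from \<open>0\<close>).
\<close>

definition orbit_enum ::
    "('k::field, 'x) free_algebra set \<Rightarrow> ('k, 'x) free_algebra set list \<Rightarrow> bool"
  where "orbit_enum I Is \<longleftrightarrow> distinct Is \<and> set Is = orbit I \<and> Is ! 0 = I"

definition adjacency_matrix :: "('k::field, 'x::finite) free_algebra set list \<Rightarrow> int mat"
  where "adjacency_matrix Is =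
    mat (length Is) (length Is) (\<lambda>(k, l). int (card {x. transition x (Is ! k) = Is ! l}))"

definition reduced_adjacency_matrix :: "('k::field, 'x::finite) free_algebra set list \<Rightarrow> int mat"
  where "reduced_adjacency_matrix Is =
    (let R = {k. k < length Is \<and> Is ! k \<noteq> right_ideal_gen {1}}
     in submatrix (adjacency_matrix Is) R R)"

definition nilpotent_mat :: "'a::semiring_1 mat \<Rightarrow> bool"
  where "nilpotent_mat A \<longleftrightarrow>
    square_mat A \<and> (\<exists>m. A ^\<^sub>m m = 0\<^sub>m (dim_row A) (dim_row A))"


section \<open>Well-definedness\<close>

lemma right_idealD:
  assumes "right_ideal I"
  shows "0 \<in> I" "f \<in> I \<Longrightarrow> g \<in> I \<Longrightarrow> f + g \<in> I" "f \<in> I \<Longrightarrow> f * h \<in> I"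
    "f \<in> I \<Longrightarrow> - f \<in> I"
proof -
  show "0 \<in> I" "f \<in> I \<Longrightarrow> g \<in> I \<Longrightarrow> f + g \<in> I" "f \<in> I \<Longrightarrow> f * h \<in> I"
    using assms by (auto simp: right_ideal_def)
  have "f \<in> I \<Longrightarrow> f * (- 1) \<in> I"
    using assms unfolding right_ideal_def by blast
  then show "f \<in> I \<Longrightarrow> - f \<in> I" by simp
qed

lemma right_ideal_gen_right_ideal: "right_ideal (right_ideal_gen S)"
  by (auto simp: right_ideal_gen_def right_ideal_def)

lemma right_ideal_gen_superset: "S \<subseteq> right_ideal_gen S"
  by (auto simp: right_ideal_gen_def)

lemma right_ideal_gen_least: "right_ideal J \<Longrightarrow> S \<subseteq> J \<Longrightarrow> right_ideal_gen S \<subseteq> J"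
  by (auto simp: right_ideal_gen_def)

lemma right_ideal_gen_one: "right_ideal_gen {1} = UNIV"
proof -
  have "1 * f \<in> right_ideal_gen {1}" for f :: "('k::field, 'x) free_algebra"
    using right_ideal_gen_superset right_idealD(3)[OF right_ideal_gen_right_ideal] by blast
  then show ?thesis by auto
qed

lemma monomial_right_ideal: "I \<in> monomial_right_ideals \<Longrightarrow> right_ideal I"
  by (auto simp: monomial_right_ideals_def right_ideal_gen_right_ideal)

lemma monomial_expansion:
  fixes f :: "'a \<Rightarrow>\<^sub>0 'b::comm_monoid_add"
  shows "(\<Sum>w\<in>Poly_Mapping.keys f. Poly_Mapping.single w (Poly_Mapping.lookup f w)) = f"
proof (rule poly_mapping_eqI)
  fix v
  have "Poly_Mapping.lookup
        (\<Sum>w\<in>Poly_Mapping.keys f. Poly_Mapping.single w (Poly_Mapping.lookup f w)) v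
      = (\<Sum>w\<in>Poly_Mapping.keys f. if w = v then Poly_Mapping.lookup f w else 0)"
    by (auto simp: lookup_sum lookup_single when_def intro!: sum.cong)
  also have "\<dots> = Poly_Mapping.lookup f v"
    by (simp add: sum.delta in_keys_iff)
  finally show "Poly_Mapping.lookup
      (\<Sum>w\<in>Poly_Mapping.keys f. Poly_Mapping.single w (Poly_Mapping.lookup f w)) v
      = Poly_Mapping.lookup f v" .
qed

lemma monomial_induct [case_names zero single sum]:
  fixes f :: "'a \<Rightarrow>\<^sub>0 'b::comm_monoid_add"
  assumes "P 0" "\<And>w c. P (Poly_Mapping.single w c)" "\<And>f g. P f \<Longrightarrow> P g \<Longrightarrow> P (f + g)"
  shows "P f"
proof -
  have "finite A \<Longrightarrow> P (\<Sum>w\<in>A. Poly_Mapping.single w (Poly_Mapping.lookup f w))" for A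
    by (induction A rule: finite_induct) (simp_all add: assms)
  from this[of "Poly_Mapping.keys f"] show ?thesis by (simp add: monomial_expansion)
qed

lemma scalar_commute:
  fixes f :: "('k::field, 'x) free_algebra"
  shows "Poly_Mapping.single 0 c * f = f * Poly_Mapping.single 0 c"
proof (induction f rule: monomial_induct)
  case zero
  then show ?case by simp
next
  case (single k v)
  then show ?case by (simp add: mult_single mult.commute)
next
  case (sum f g)
  then show ?case by (simp add: distrib_left distrib_right)
qed

lemma free_algebra_module_simps [simp]:
  "carrier free_algebra_module = UNIV"
  "zero free_algebra_module = 0"
  "f \<oplus>\<^bsub>free_algebra_module\<^esub> g = f + g"
  "c \<odot>\<^bsub>free_algebra_module\<^esub> f = Poly_Mapping.single 0 c * f"
  by (simp_all add: free_algebra_module_def)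

lemma coset_eq: "I +>\<^bsub>free_algebra_module\<^esub> f = {g. g - f \<in> I}"
  by (force simp: a_r_coset_def r_coset_def)

lemma coset_add:
  assumes "right_ideal I"
  shows "{h. h - f \<in> I} <+>\<^bsub>free_algebra_module\<^esub> {h. h - g \<in> I} = {h. h - (f + g) \<in> I}"
proof (intro equalityI subsetI)
  fix h assume "h \<in> {h. h - f \<in> I} <+>\<^bsub>free_algebra_module\<^esub> {h. h - g \<in> I}"
  then obtain a b where "a - f \<in> I" "b - g \<in> I" "h = a + b"
    by (auto simp: set_add_def')
  moreover have "a + b - (f + g) = (a - f) + (b - g)" by simp
  ultimately show "h \<in> {h. h - (f + g) \<in> I}"
    using right_idealD(2)[OF assms] by (simp only: mem_Collect_eq)
next
  fix h assume "h \<in> {h. h - (f + g) \<in> I}"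
  then have "(h - g) - f \<in> I" by (simp add: algebra_simps)
  moreover have "g - g \<in> I" using right_idealD(1)[OF assms] by simp
  moreover have "h = (h - g) + g" by simp
  ultimately show "h \<in> {h. h - f \<in> I} <+>\<^bsub>free_algebra_module\<^esub> {h. h - g \<in> I}"
    unfolding set_add_def' free_algebra_module_simps by blast
qed

lemma coset_smult:
  assumes "right_ideal I"
  shows "(\<Union>a\<in>{h. h - f \<in> I}. {h. h - Poly_Mapping.single 0 c * a \<in> I})
    = {h. h - Poly_Mapping.single 0 c * f \<in> I}"
proof (intro equalityI subsetI)
  fix h assume "h \<in> (\<Union>a\<in>{h. h - f \<in> I}. {h. h - Poly_Mapping.single 0 c * a \<in> I})"
  then obtain a where a: "a - f \<in> I" "h - Poly_Mapping.single 0 c * a \<in> I" by auto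
  have "(a - f) * Poly_Mapping.single 0 c \<in> I" using a right_idealD(3)[OF assms] by simp
  then have "Poly_Mapping.single 0 c * a - Poly_Mapping.single 0 c * f \<in> I"
    by (simp add: scalar_commute left_diff_distrib)
  from right_idealD(2)[OF assms a(2) this] show "h \<in> {h. h - Poly_Mapping.single 0 c * f \<in> I}"
    by simp
next
  fix h assume "h \<in> {h. h - Poly_Mapping.single 0 c * f \<in> I}"
  then show "h \<in> (\<Union>a\<in>{h. h - f \<in> I}. {h. h - Poly_Mapping.single 0 c * a \<in> I})"
    using right_idealD(1)[OF assms] by force
qed

lemma cyclic_module_simps:
  shows "carrier (cyclic_module I) = range (\<lambda>f. {h. h - f \<in> I})"
    and "zero (cyclic_module I) = {h. h - 0 \<in> I}"
    and "right_ideal I \<Longrightarrow>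
      {h. h - f \<in> I} \<oplus>\<^bsub>cyclic_module I\<^esub> {h. h - g \<in> I} = {h. h - (f + g) \<in> I}"
    and "right_ideal I \<Longrightarrow>
      c \<odot>\<^bsub>cyclic_module I\<^esub> {h. h - f \<in> I} = {h. h - Poly_Mapping.single 0 c * f \<in> I}"
proof -
  show "carrier (cyclic_module I) = range (\<lambda>f. {h. h - f \<in> I})"
    unfolding cyclic_module_def A_RCOSETS_def RCOSETS_def a_r_coset_def[symmetric]
    by (auto simp: coset_eq)
  show "zero (cyclic_module I) = {h. h - 0 \<in> I}"
    by (simp add: cyclic_module_def)
  show "right_ideal I \<Longrightarrow>
      {h. h - f \<in> I} \<oplus>\<^bsub>cyclic_module I\<^esub> {h. h - g \<in> I} = {h. h - (f + g) \<in> I}"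
    by (simp add: cyclic_module_def coset_add)
  show "right_ideal I \<Longrightarrow>
      c \<odot>\<^bsub>cyclic_module I\<^esub> {h. h - f \<in> I} = {h. h - Poly_Mapping.single 0 c * f \<in> I}"
    by (simp add: cyclic_module_def coset_eq coset_smult)
qed

lemma cyclic_module_vectorspace:
  fixes I :: "('k::field, 'x) free_algebra set"
  assumes "right_ideal I"
  shows "vectorspace (class_ring :: 'k ring) (cyclic_module I)"
proof -
  note s = cyclic_module_simps(1,2) cyclic_module_simps(3,4)[OF assms]
  have inv: "\<exists>y\<in>carrier (cyclic_module I). y \<oplus>\<^bsub>cyclic_module I\<^esub> x = \<zero>\<^bsub>cyclic_module I\<^esub>"
    if x: "x \<in> carrier (cyclic_module I)" for x
  proof -
    obtain f where f: "x = {h. h - f \<in> I}" using x by (auto simp: s)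
    have "{h. h - (- f) \<in> I} \<in> carrier (cyclic_module I)" unfolding s by (rule rangeI)
    moreover have "{h. h - (- f) \<in> I} \<oplus>\<^bsub>cyclic_module I\<^esub> x = \<zero>\<^bsub>cyclic_module I\<^esub>"
      by (simp only: f s) simp
    ultimately show ?thesis by blast
  qed
  have ag: "abelian_group (cyclic_module I)"
  proof (rule abelian_groupI)
    show "\<And>x. x \<in> carrier (cyclic_module I) \<Longrightarrow>
      \<exists>y\<in>carrier (cyclic_module I). y \<oplus>\<^bsub>cyclic_module I\<^esub> x = \<zero>\<^bsub>cyclic_module I\<^esub>"
      by (rule inv)
  qed (auto simp only: s add.assoc add.commute add.left_commute add_0_left add_0_right
      image_iff UNIV_I bex_simps)
  have R: "cring (class_ring :: 'k ring)" by (rule class_cring.is_cring)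
  have d: "Poly_Mapping.single 0 (a + b) * f
      = Poly_Mapping.single 0 a * f + Poly_Mapping.single 0 b * f"
    for a b :: 'k and f :: "('k, 'x) free_algebra"
    by (simp add: single_add distrib_right)
  have m: "Poly_Mapping.single 0 (a * b) * f
      = Poly_Mapping.single 0 a * (Poly_Mapping.single 0 b * f)"
    for a b :: 'k and f :: "('k, 'x) free_algebra"
    by (simp add: mult_single flip: mult.assoc)
  have "module (class_ring :: 'k ring) (cyclic_module I)"
    by (rule moduleI[OF R ag])
      (auto simp: s class_ring_simps d m distrib_left simp del: diff_zero)
  then show ?thesis
    by (simp add: vectorspace_def class_field)
qed

lemma orbit_least:
  assumes "I \<in> S" "\<And>x J. J \<in> S \<Longrightarrow> transition x J \<in> S"
  shows "orbit I \<subseteq> S"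
proof
  fix J assume "J \<in> orbit I"
  then show "J \<in> S" by induction (use assms in auto)
qed

lemma monomial_sum:
  fixes f :: "('k::field, 'x) free_algebra"
  assumes "right_ideal I" "\<And>w. w \<in> Poly_Mapping.keys f \<Longrightarrow> word_monomial w \<in> I"
  shows "f \<in> I"
proof -
  have fin: "(\<Sum>w\<in>A. Poly_Mapping.single w (Poly_Mapping.lookup f w)) \<in> I"
    if "finite A" "A \<subseteq> Poly_Mapping.keys f" for A
    using that
  proof induction
    case empty
    then show ?case using right_idealD(1)[OF assms(1)] by simp
  next
    case (insert w A)
    have "word_monomial w * Poly_Mapping.single 0 (Poly_Mapping.lookup f w) \<in> I"
      using right_idealD(3)[OF assms(1)] assms(2) insert.prems by blast
    then have "Poly_Mapping.single w (Poly_Mapping.lookup f w) \<in> I"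
      by (simp add: word_monomial_def mult_single)
    then show ?case using insert right_idealD(2)[OF assms(1)] by simp
  qed
  have "(\<Sum>w\<in>Poly_Mapping.keys f. Poly_Mapping.single w (Poly_Mapping.lookup f w)) = f"
    by (rule monomial_expansion)
  then show ?thesis using fin[of "Poly_Mapping.keys f"] by simp
qed

lemma monomial_right_ideal_keys:
  fixes I :: "('k::field, 'x) free_algebra set"
  assumes "I \<in> monomial_right_ideals" "f \<in> I" "w \<in> Poly_Mapping.keys f"
  shows "word_monomial w \<in> I"
proof -
  obtain G where I: "I = right_ideal_gen (word_monomial ` G)"
    using assms(1) by (auto simp: monomial_right_ideals_def)
  let ?J = "{f :: ('k, 'x) free_algebra. \<forall>w\<in>Poly_Mapping.keys f. \<exists>g\<in>G. \<exists>u. w = g + u}"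
  have "right_ideal ?J"
    unfolding right_ideal_def
  proof (intro conjI ballI allI)
    fix f g assume fg: "f \<in> ?J" "g \<in> ?J"
    then show "f + g \<in> ?J" using Poly_Mapping.keys_add[of f g] by blast
  next
    fix f g assume f: "f \<in> ?J"
    have "\<exists>h\<in>G. \<exists>u. a + b = h + u" if a: "a \<in> Poly_Mapping.keys f" for a b
    proof -
      obtain h u where "h \<in> G" "a = h + u" using f a by blast
      then have "h \<in> G" "a + b = h + (u + b)" by (simp_all add: add.assoc)
      then show ?thesis by blast
    qed
    then show "f * g \<in> ?J" using keys_mult[of f g] by blast
  qed simp
  moreover have "word_monomial ` G \<subseteq> ?J"
  proof (intro image_subsetI CollectI ballI)
    fix g w assume g: "g \<in> G"
      and w: "w \<in> Poly_Mapping.keys (word_monomial g :: ('k, 'x) free_algebra)"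
    from w have "w = g" by (simp add: word_monomial_def)
    then have "w = g + 0" by simp
    with g show "\<exists>g\<in>G. \<exists>u. w = g + u" by blast
  qed
  ultimately have "f \<in> ?J" using right_ideal_gen_least assms(2) I by blast
  then obtain g u where gu: "g \<in> G" "w = g + u" using assms(3) by blast
  have "word_monomial g \<in> I"
    unfolding I using gu(1) by (intro subsetD[OF right_ideal_gen_superset] imageI)
  then have "word_monomial g * word_monomial u \<in> I"
    unfolding I by (rule right_idealD(3)[OF right_ideal_gen_right_ideal])
  then show ?thesis by (simp add: word_monomial_def mult_single gu)
qed

lemma keys_var_mult:
  fixes f :: "('k::field, 'x) free_algebra"
  assumes "w \<in> Poly_Mapping.keys f"
  shows "Word [x] + w \<in> Poly_Mapping.keys (var x * f)"
proof -
  have l: "Poly_Mapping.lookup (var x * f) (Word [x] + w) = Poly_Mapping.lookup f w"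
  proof (induction f rule: monomial_induct)
    case zero
  then show ?case by simp
next
  case (single k v)
    have "Word [x] + k = Word [x] + w \<longleftrightarrow> k = w"
      by (cases k; cases w) (simp add: plus_word_def)
    moreover have "var x * Poly_Mapping.single k v = Poly_Mapping.single (Word [x] + k) v"
      unfolding var_def word_monomial_def mult_single by (simp only: mult_1_left)
    ultimately show ?case by (simp only: lookup_single)
  next
    case (sum f g)
    then show ?case by (simp add: distrib_left lookup_add)
  qed
  then show ?thesis using assms by (simp add: in_keys_iff)
qed

lemma transition_monomial:
  assumes "I \<in> monomial_right_ideals"
  shows "transition x I \<in> monomial_right_ideals"
proof -
  let ?G = "{w. word_monomial w \<in> transition x I}"
  have r: "right_ideal I" by (rule monomial_right_ideal[OF assms])
  have t: "right_ideal (transition x I)"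
    using right_idealD[OF r]
    by (auto simp: right_ideal_def transition_def distrib_left simp flip: mult.assoc)
  have "transition x I = right_ideal_gen (word_monomial ` ?G)"
  proof
    show "right_ideal_gen (word_monomial ` ?G) \<subseteq> transition x I"
      by (rule right_ideal_gen_least[OF t]) auto
    show "transition x I \<subseteq> right_ideal_gen (word_monomial ` ?G)"
    proof
      fix f assume f: "f \<in> transition x I"
      show "f \<in> right_ideal_gen (word_monomial ` ?G)"
      proof (rule monomial_sum[OF right_ideal_gen_right_ideal])
        fix w assume "w \<in> Poly_Mapping.keys f"
        then have "word_monomial (Word [x] + w) \<in> I"
          using monomial_right_ideal_keys[OF assms _ keys_var_mult] f
          unfolding transition_def mem_Collect_eq by blast
        then have "word_monomial w \<in> transition x I"
          by (simp only: transition_def var_def word_monomial_def mult_single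
              mult_1_left mem_Collect_eq)
        then have "word_monomial w \<in> word_monomial ` ?G"
          by (intro imageI CollectI)
        with right_ideal_gen_superset
        show "word_monomial w \<in> right_ideal_gen (word_monomial ` ?G)"
          by (rule subsetD)
      qed
    qed
  qed
  then show ?thesis by (auto simp: monomial_right_ideals_def)
qed

lemma orbit_monomial: "I \<in> monomial_right_ideals \<Longrightarrow> orbit I \<subseteq> monomial_right_ideals"
  by (rule orbit_least) (auto intro: transition_monomial)

lemma orbit_enum_exists:
  assumes "regular I"
  shows "\<exists>Is. orbit_enum I Is"
proof -
  obtain xs where "set xs = orbit I - {I}" "distinct xs"
    using finite_distinct_list[of "orbit I - {I}"] assms by (auto simp: regular_def)
  then have "orbit_enum I (I # xs)"
    using orbit.base[of I] by (auto simp: orbit_enum_def)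
  then show ?thesis ..
qed

end

theory Submission
  imports Defs
begin

text \<open>
  Both properties say that \<open>I\<close> contains all words of some fixed length \<open>m\<close>.  For \<open>F/I\<close>, the cosets of
  the words outside \<open>I\<close> form a basis.  For the matrix, an entry of its \<open>m\<close>-th power is non-zero iff some
  word of length \<open>m\<close> leads from one given proper ideal of the orbit to another, and the word \<open>w\<close>
  leads from \<open>J\<close> to \<open>\<langle>1\<rangle>\<close> iff \<open>w \<in> J\<close>.
\<close>

section \<open>Words, cosets and finite dimension\<close>

lemma word_monomial_append:
  "(word_monomial (Word (u @ v)) :: ('k::field, 'x) free_algebra)
    = word_monomial (Word u) * word_monomial (Word v)"
  by (simp add: word_monomial_def mult_single plus_word_def)

lemma word_monomial_Nil: "(word_monomial (Word []) :: ('k::field, 'x) free_algebra) = 1"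
  by (simp add: word_monomial_def flip: zero_word_def)

lemma right_ideal_coset_eq_iff:
  assumes "right_ideal I"
  shows "{h. h - f \<in> I} = {h. h - g \<in> I} \<longleftrightarrow> f - g \<in> I"
proof
  assume "{h. h - f \<in> I} = {h. h - g \<in> I}"
  moreover have "f \<in> {h. h - f \<in> I}" using right_idealD(1)[OF assms] by simp
  ultimately show "f - g \<in> I" by blast
next
  assume fg: "f - g \<in> I"
  have "h - g \<in> I" if "h - f \<in> I" for h
    using right_idealD(2)[OF assms that fg] by simp
  moreover have "h - f \<in> I" if "h - g \<in> I" for h
    using right_idealD(2)[OF assms that right_idealD(4)[OF assms fg]] by simp
  ultimately show "{h. h - f \<in> I} = {h. h - g \<in> I}" by blast
qed

text \<open>The prefix of length \<open>m\<close> lies in \<open>I\<close>, and a right ideal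
  absorbs the remaining factor.\<close>

lemma word_monomial_mem_mono_length:
  assumes "right_ideal I" "\<And>u. length u = m \<Longrightarrow> word_monomial (Word u) \<in> I" "m \<le> length w"
  shows "word_monomial (Word w) \<in> I"
proof -
  have "word_monomial (Word (take m w)) * word_monomial (Word (drop m w)) \<in> I"
    using assms by (intro right_idealD(3)) auto
  then show ?thesis by (simp flip: word_monomial_append)
qed

text \<open>Representatives of a finite spanning set involve only words up to some length
  \<open>D\<close>, so every coset has a representative of degree at most \<open>D\<close>.
  Comparing a longer word with such a representative forces the word into \<open>I\<close>.\<close>

lemma fin_dim_cyclic_module_imp:
  fixes I :: "('k::field, 'x) free_algebra set"
  assumes "I \<in> monomial_right_ideals"
    and fd: "vectorspace.fin_dim (class_ring :: 'k ring) (cyclic_module I)"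
  shows "\<exists>m. \<forall>w. length w = m \<longrightarrow> word_monomial (Word w) \<in> I"
proof -
  have r: "right_ideal I" by (rule monomial_right_ideal[OF assms(1)])
  interpret V: vectorspace "class_ring :: 'k ring" "cyclic_module I"
    by (rule cyclic_module_vectorspace[OF r])
  note s = cyclic_module_simps(1,2) cyclic_module_simps(3,4)[OF r]
  let ?c = "\<lambda>f. {h. h - f \<in> I}"
  obtain A where A: "finite A" "A \<subseteq> range ?c" "V.span A = range ?c"
    using fd unfolding V.fin_dim_def s(1) by blast
  then obtain F where F: "finite F" "A = ?c ` F"
    by (meson finite_subset_image)
  have "finite (\<Union>f\<in>F. (length \<circ> letters) ` Poly_Mapping.keys f)" using F(1) by auto
  then obtain D where "\<forall>n\<in>(\<Union>f\<in>F. (length \<circ> letters) ` Poly_Mapping.keys f). n \<le> D"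
    unfolding finite_nat_set_iff_bounded_le by blast
  then have D: "length (letters w) \<le> D" if "f \<in> F" "w \<in> Poly_Mapping.keys f" for f w
    using that by auto
  let ?P = "{f :: ('k, 'x) free_algebra. \<forall>w\<in>Poly_Mapping.keys f. length (letters w) \<le> D}"
  have P_add: "f + g \<in> ?P" if "f \<in> ?P" "g \<in> ?P" for f g
    using that Poly_Mapping.keys_add[of f g] by blast
  have P_smult: "Poly_Mapping.single 0 c * f \<in> ?P" if "f \<in> ?P" for c f
  proof -
    have "Poly_Mapping.keys (Poly_Mapping.single 0 c * f) \<subseteq> Poly_Mapping.keys f"
      using keys_mult[of "Poly_Mapping.single 0 c" f] by (auto split: if_splits)
    then show ?thesis using that by blast
  qed
  \<comment> \<open>The cosets represented in degree at most \<open>D\<close> form a submodule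
    containing \<open>A\<close>, hence they contain its span, which is everything.\<close>
  have sub: "submodule class_ring (?c ` ?P) (cyclic_module I)"
  proof unfold_locales
    show "?c ` ?P \<subseteq> carrier (cyclic_module I)" unfolding s by blast
    show "v \<oplus>\<^bsub>cyclic_module I\<^esub> w \<in> ?c ` ?P" if vw: "v \<in> ?c ` ?P" "w \<in> ?c ` ?P" for v w
    proof -
      obtain f g where "f \<in> ?P" "v = ?c f" "g \<in> ?P" "w = ?c g" using vw by blast
      then show ?thesis using s(3) P_add by blast
    qed
    have "0 \<in> ?P" by simp
    then show "\<zero>\<^bsub>cyclic_module I\<^esub> \<in> ?c ` ?P" unfolding s by (rule imageI)
    show "c \<odot>\<^bsub>cyclic_module I\<^esub> v \<in> ?c ` ?P" if v: "v \<in> ?c ` ?P" for c v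
    proof -
      obtain f where "f \<in> ?P" "v = ?c f" using v by blast
      then show ?thesis using s(4) P_smult by blast
    qed
  qed
  have "A \<subseteq> ?c ` ?P" unfolding F(2) using D by blast
  from V.span_is_subset[OF this sub] have all: "range ?c \<subseteq> ?c ` ?P"
    unfolding A(3) .
  have "word_monomial (Word w) \<in> I" if w: "length w = Suc D" for w
  proof -
    obtain g where g: "g \<in> ?P" "?c (word_monomial (Word w)) = ?c g"
      using all by blast
    then have d: "word_monomial (Word w) - g \<in> I"
      using right_ideal_coset_eq_iff[OF r] by blast
    \<comment> \<open>Since \<open>w\<close> is longer than \<open>D\<close>, it cannot cancel
      against \<open>g\<close>; a monomial ideal contains each word occurring in one of its
      elements.\<close>
    have "Word w \<notin> Poly_Mapping.keys g" using g(1) w by force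
    then have "Word w \<in> Poly_Mapping.keys (word_monomial (Word w) - g)"
      by (simp add: in_keys_iff lookup_minus word_monomial_def)
    then show ?thesis by (rule monomial_right_ideal_keys[OF assms(1) d])
  qed
  then show ?thesis by blast
qed

text \<open>Over a finite alphabet there are finitely many words of length at most \<open>m\<close>.
  Their cosets span, because every longer word lies in \<open>I\<close> and has coset zero.\<close>

lemma fin_dim_cyclic_moduleI:
  fixes I :: "('k::field, 'x::finite) free_algebra set"
  assumes r: "right_ideal I"
    and m: "\<And>w. length w = m \<Longrightarrow> word_monomial (Word w) \<in> I"
  shows "vectorspace.fin_dim (class_ring :: 'k ring) (cyclic_module I)"
proof -
  interpret V: vectorspace "class_ring :: 'k ring" "cyclic_module I"
    by (rule cyclic_module_vectorspace[OF r])
  note s = cyclic_module_simps(1,2) cyclic_module_simps(3,4)[OF r]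
  let ?c = "\<lambda>f. {h. h - f \<in> I}"
  let ?A = "(\<lambda>w. ?c (word_monomial (Word w))) ` {w. length w \<le> m}"
  have fin: "finite ?A"
    using finite_lists_length_le[of "UNIV :: 'x set" m] by simp
  have sub: "?A \<subseteq> carrier (cyclic_module I)" unfolding s by blast
  note sm = V.span_is_submodule[OF sub, unfolded submodule_def]
  have "?c f \<in> V.span ?A" for f
  proof (induction f rule: monomial_induct)
    case zero
    then show ?case using sm unfolding s by blast
  next
    case (single w c)
    have "?c (word_monomial w) \<in> V.span ?A"
    proof (cases "length (letters w) \<le> m")
      case True
      then have "?c (word_monomial (Word (letters w))) \<in> ?A" by blast
      then show ?thesis using V.in_own_span[OF sub] by auto
    next
      case False
      have "word_monomial (Word (letters w)) \<in> I"
        by (rule word_monomial_mem_mono_length[of I m, OF r]) (use False m in simp_all)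
      then have "?c (word_monomial w) = ?c 0"
        unfolding right_ideal_coset_eq_iff[OF r] by simp
      then show ?thesis using sm unfolding s by simp
    qed
    then have "c \<odot>\<^bsub>cyclic_module I\<^esub> ?c (word_monomial w) \<in> V.span ?A"
      using sm by (simp add: class_ring_simps)
    then show ?case by (simp add: s word_monomial_def mult_single)
  next
    case (sum f g)
    then have "?c f \<oplus>\<^bsub>cyclic_module I\<^esub> ?c g \<in> V.span ?A" using sm by blast
    then show ?case by (simp only: s)
  qed
  then have "V.span ?A = carrier (cyclic_module I)"
    using V.span_is_subset2[OF sub] unfolding s by blast
  then show ?thesis unfolding V.fin_dim_def using fin sub by blast
qed

section \<open>Transitions along words\<close>

text \<open>Colon ideals compose, \<open>(J : x) : w\<close> being \<open>J : xw\<close>, and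
  \<open>fold\<close> consumes the word from the left, so no reversal occurs.\<close>

lemma fold_transition:
  "fold transition w J = {f. word_monomial (Word w) * f \<in> (J :: ('k::field, 'x) free_algebra set)}"
proof (induction w arbitrary: J)
  case Nil
  then show ?case by (simp add: word_monomial_Nil)
next
  case (Cons x w)
  have "word_monomial (Word (x # w)) = var x * (word_monomial (Word w) :: ('k, 'x) free_algebra)"
    using word_monomial_append[of "[x]" w] by (simp add: var_def)
  then show ?case unfolding fold_simps Cons.IH by (simp add: transition_def mult.assoc)
qed

text \<open>Test with \<open>1\<close>: it lies in \<open>J : w\<close> exactly when the word
  \<open>w\<close> lies in \<open>J\<close>.\<close>

lemma fold_transition_eq_UNIV_iff:
  assumes "right_ideal J"
  shows "fold transition w J = UNIV \<longleftrightarrow> word_monomial (Word w) \<in> J"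
proof
  assume "fold transition w J = UNIV"
  then have "1 \<in> fold transition w J" by simp
  then show "word_monomial (Word w) \<in> J" by (simp add: fold_transition)
next
  assume "word_monomial (Word w) \<in> J"
  then show "fold transition w J = UNIV"
    using right_idealD(3)[OF assms] by (auto simp: fold_transition)
qed

lemma fold_transition_orbit: "J \<in> orbit I \<Longrightarrow> fold transition w J \<in> orbit I"
  by (induction w arbitrary: J) (auto intro: orbit.step)

lemma orbit_fold_transition: "J \<in> orbit I \<Longrightarrow> \<exists>w. J = fold transition w I"
proof (induction rule: orbit.induct)
  case base
  have "I = fold transition [] I" by simp
  then show ?case by (rule exI)
next
  case (step J x)
  then obtain w where "J = fold transition w I" by blast
  then have "transition x J = fold transition (w @ [x]) I" by simp
  then show ?case by (rule exI)
qed

section \<open>Powers of the reduced adjacency matrix\<close>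

text \<open>An entry depends only on its two ideals, so deleting the row and column of
  \<open>UNIV\<close>, which is the ideal generated by \<open>1\<close>, amounts to dropping
  \<open>UNIV\<close> from the list.\<close>

lemma reduced_adjacency_matrix_eq:
  "reduced_adjacency_matrix Is
    = adjacency_matrix (filter (\<lambda>J. J \<noteq> UNIV) (Is :: ('k::field, 'x::finite) free_algebra set list))"
proof -
  define R where "R = {k. k < length Is \<and> Is ! k \<noteq> UNIV}"
  have f: "filter (\<lambda>J. J \<noteq> UNIV) Is = nths Is R"
    unfolding R_def by (rule filter_eq_nths)
  have R: "{i. i < length Is \<and> i \<in> R} = R" unfolding R_def by blast
  \<comment> \<open>\<open>submatrix\<close> and \<open>nths\<close> select positions in the same
    order, described by \<open>pick\<close>.\<close>
  have n: "nths Is R ! i = Is ! pick R i" if "i < card R" for i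
    using nth_nths[of i Is R] that by (simp add: R)
  have p: "pick R i < length Is" if "i < card R" for i
    using pick_in_set_le[OF that] by (simp add: R_def)
  show ?thesis
    unfolding reduced_adjacency_matrix_def right_ideal_gen_one f R_def[symmetric] Let_def
    by (rule eq_matI)
      (simp_all add: submatrix_def adjacency_matrix_def length_nths R n p)
qed

text \<open>
  The hypothesis says that a path between members of the list passes only through members of it.
\<close>

lemma adjacency_matrix_pow:
  fixes Js :: "('k::field, 'x::finite) free_algebra set list"
  assumes "\<And>J w x. J \<in> set Js \<Longrightarrow> transition x (fold transition w J) \<in> set Js
      \<Longrightarrow> fold transition w J \<in> set Js"
    and dist: "distinct Js" and "i < length Js" "j < length Js"
  shows "(adjacency_matrix Js ^\<^sub>m m) $$ (i, j) \<ge> 0 \<and>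
    ((adjacency_matrix Js ^\<^sub>m m) $$ (i, j) = 0 \<longleftrightarrow>
      (\<forall>w. length w = m \<longrightarrow> fold transition w (Js ! i) \<noteq> Js ! j))"
  using assms(4)
proof (induction m arbitrary: j)
  \<comment> \<open>The empty word is the only one of length 0; as \<open>Js\<close> is distinct, it
    joins positions \<open>i\<close> and \<open>j\<close> exactly where the identity matrix has a
    1.\<close>
  case 0
  then show ?case using assms(3) dist
    by (auto simp: adjacency_matrix_def nth_eq_iff_index_eq)
next
  case (Suc m)
  let ?A = "adjacency_matrix Js" and ?n = "length Js"
  have A: "?A \<in> carrier_mat ?n ?n" by (simp add: adjacency_matrix_def)
  have e: "?A $$ (l, j) = int (card {x. transition x (Js ! l) = Js ! j})" if "l < ?n" for l
    using that Suc.prems by (simp add: adjacency_matrix_def)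
  have sum: "(?A ^\<^sub>m Suc m) $$ (i, j) = (\<Sum>l<?n. (?A ^\<^sub>m m) $$ (i, l) * ?A $$ (l, j))"
    using A assms(3) Suc.prems pow_carrier_mat[OF A, of m]
    by (auto simp: scalar_prod_def lessThan_atLeast0 intro!: sum.cong)
  \<comment> \<open>Non-negativity is carried through the induction so that the sum vanishes only if
    each summand does.\<close>
  have nn: "(?A ^\<^sub>m m) $$ (i, l) * ?A $$ (l, j) \<ge> 0" if "l < ?n" for l
    using Suc.IH[OF that] e[OF that] by simp
  have "(?A ^\<^sub>m Suc m) $$ (i, j) = 0 \<longleftrightarrow>
      (\<forall>l<?n. (?A ^\<^sub>m m) $$ (i, l) * ?A $$ (l, j) = 0)"
    unfolding sum by (subst sum_nonneg_eq_0_iff) (auto simp: nn)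
  also have "\<dots> \<longleftrightarrow> (\<forall>l<?n. (\<forall>w. length w = m \<longrightarrow> fold transition w (Js ! i) \<noteq> Js ! l)
      \<or> (\<forall>x. transition x (Js ! l) \<noteq> Js ! j))"
    using Suc.IH e by simp
  also have "\<dots> \<longleftrightarrow> (\<forall>w x. length w = m \<longrightarrow> transition x (fold transition w (Js ! i)) \<noteq> Js ! j)"
  proof
    assume L: "\<forall>l<?n. (\<forall>w. length w = m \<longrightarrow> fold transition w (Js ! i) \<noteq> Js ! l)
      \<or> (\<forall>x. transition x (Js ! l) \<noteq> Js ! j)"
    show "\<forall>w x. length w = m \<longrightarrow> transition x (fold transition w (Js ! i)) \<noteq> Js ! j"
    proof (intro allI impI notI)
      fix w x assume wx: "length w = m" "transition x (fold transition w (Js ! i)) = Js ! j"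
      \<comment> \<open>The path hypothesis ensures that the intermediate ideal is indexed by some
        summand \<open>l\<close>.\<close>
      then have "fold transition w (Js ! i) \<in> set Js"
        using assms(1)[of "Js ! i" x w] assms(3) Suc.prems by simp
      then obtain l where "l < ?n" "fold transition w (Js ! i) = Js ! l"
        by (metis in_set_conv_nth)
      then show False using L wx by metis
    qed
  qed metis
  \<comment> \<open>The new matrix factor stands on the right and corresponds to the last letter of
    the longer word.\<close>
  also have "\<dots> \<longleftrightarrow> (\<forall>w. length w = Suc m \<longrightarrow> fold transition w (Js ! i) \<noteq> Js ! j)"
  proof (intro iffI allI impI)
    fix w :: "'x list" and x
    assume *: "\<forall>w. length w = Suc m \<longrightarrow> fold transition w (Js ! i) \<noteq> Js ! j" "length w = m"
    show "transition x (fold transition w (Js ! i)) \<noteq> Js ! j"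
      using *(1)[rule_format, of "w @ [x]"] *(2) by simp
  qed (auto simp: length_Suc_conv_rev)
  finally show ?case unfolding sum by (auto intro!: sum_nonneg nn)
qed

theorem theorem6p2:
  fixes I :: "('k::field, 'x::finite) free_algebra set"
    and Is :: "('k, 'x) free_algebra set list"
  assumes "I \<in> monomial_right_ideals"
    and "carrier (cyclic_module I) \<noteq> {\<zero>\<^bsub>cyclic_module I\<^esub>}"
    and "regular I"
    and "orbit_enum I Is"
  shows "vectorspace.fin_dim (class_ring :: 'k ring) (cyclic_module I)
     \<longleftrightarrow> nilpotent_mat (reduced_adjacency_matrix Is)"
proof -
  define Js where "Js = filter (\<lambda>J. J \<noteq> UNIV) Is"
  have r: "right_ideal J" if "J \<in> orbit I" for J
    using that orbit_monomial[OF assms(1)] monomial_right_ideal by blast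
  note rI = r[OF orbit.base]
  \<comment> \<open>For \<open>I = UNIV\<close> there is only one coset. Properness keeps
    \<open>I\<close> itself in the list \<open>Js\<close>.\<close>
  have ne: "I \<noteq> UNIV"
  proof
    assume "I = UNIV"
    then show False using assms(2) by (simp add: cyclic_module_simps(1,2))
  qed
  have Js: "set Js = orbit I - {UNIV}" "distinct Js"
    using assms(4) by (auto simp: Js_def orbit_enum_def)
  \<comment> \<open>\<open>UNIV\<close> is absorbing: every transition fixes it, so a path that ends
    at a proper ideal never visited it.\<close>
  have path: "fold transition w J \<in> set Js"
    if "J \<in> set Js" "transition x (fold transition w J) \<in> set Js" for J w x
    using that by (auto simp: Js(1) fold_transition_orbit transition_def)
  have A: "adjacency_matrix Js \<in> carrier_mat (length Js) (length Js)"
    by (simp add: adjacency_matrix_def)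
  have pow: "adjacency_matrix Js ^\<^sub>m m = 0\<^sub>m (length Js) (length Js) \<longleftrightarrow>
      (\<forall>J\<in>set Js. \<forall>w. length w = m \<longrightarrow> word_monomial (Word w) \<in> J)" for m
  proof -
    have "adjacency_matrix Js ^\<^sub>m m = 0\<^sub>m (length Js) (length Js) \<longleftrightarrow>
        (\<forall>i<length Js. \<forall>j<length Js. (adjacency_matrix Js ^\<^sub>m m) $$ (i, j) = 0)"
      using pow_carrier_mat[OF A, of m] by (auto simp: mat_eq_iff)
    also have "\<dots> \<longleftrightarrow> (\<forall>i<length Js. \<forall>j<length Js. \<forall>w. length w = m
        \<longrightarrow> fold transition w (Js ! i) \<noteq> Js ! j)"
      using adjacency_matrix_pow[OF path Js(2)] by simp
    also have "\<dots> \<longleftrightarrow> (\<forall>J\<in>set Js. \<forall>K\<in>set Js. \<forall>w. length w = m \<longrightarrow> fold transition w J \<noteq> K)"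
      by (simp only: all_set_conv_all_nth)
    also have "\<dots> \<longleftrightarrow> (\<forall>J\<in>set Js. \<forall>w. length w = m \<longrightarrow> fold transition w J = UNIV)"
    proof -
      \<comment> \<open>A path cannot leave the orbit, so avoiding all its proper members means
        arriving at \<open>UNIV\<close>.\<close>
      have "(\<forall>K\<in>set Js. fold transition w J \<noteq> K) \<longleftrightarrow> fold transition w J = UNIV"
        if "J \<in> set Js" for J w
        using that fold_transition_orbit[of J I w] unfolding Js(1) by blast
      then show ?thesis by blast
    qed
    also have "\<dots> \<longleftrightarrow> (\<forall>J\<in>set Js. \<forall>w. length w = m \<longrightarrow> word_monomial (Word w) \<in> J)"
      using r by (simp add: Js(1) fold_transition_eq_UNIV_iff)
    finally show ?thesis .
  qed
  \<comment> \<open>One exponent serves the whole orbit: if \<open>J\<close> is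
    \<open>I : u\<close>, then \<open>w\<close> lies in \<open>J\<close> because \<open>uw\<close>,
    of length at least \<open>m\<close>, lies in \<open>I\<close>.\<close>
  have orb: "word_monomial (Word w) \<in> J"
    if m: "\<And>u. length u = m \<Longrightarrow> word_monomial (Word u) \<in> I"
      and J: "J \<in> orbit I" and w: "length w = m" for J m w
  proof -
    obtain u where u: "J = fold transition u I" using orbit_fold_transition[OF J] by blast
    have "word_monomial (Word (u @ w)) \<in> I"
      by (rule word_monomial_mem_mono_length[of I m, OF rI]) (simp_all add: m w)
    then show ?thesis by (simp add: u fold_transition word_monomial_append)
  qed
  have "vectorspace.fin_dim (class_ring :: 'k ring) (cyclic_module I) \<longleftrightarrow>
      (\<exists>m. \<forall>w. length w = m \<longrightarrow> word_monomial (Word w) \<in> I)"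
    using fin_dim_cyclic_module_imp[OF assms(1)] fin_dim_cyclic_moduleI[OF rI] by metis
  also have "\<dots> \<longleftrightarrow> (\<exists>m. \<forall>J\<in>set Js. \<forall>w. length w = m \<longrightarrow> word_monomial (Word w) \<in> J)"
  proof (intro iffI)
    assume "\<exists>m. \<forall>w. length w = m \<longrightarrow> word_monomial (Word w) \<in> I"
    then obtain m where "\<And>w. length w = m \<Longrightarrow> word_monomial (Word w) \<in> I" by blast
    from orb[OF this] show "\<exists>m. \<forall>J\<in>set Js. \<forall>w. length w = m \<longrightarrow> word_monomial (Word w) \<in> J"
      unfolding Js(1) by blast
  next
    have "I \<in> set Js" using ne orbit.base[of I] by (simp add: Js(1))
    then show "\<exists>m. \<forall>w. length w = m \<longrightarrow> word_monomial (Word w) \<in> I"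
      if "\<exists>m. \<forall>J\<in>set Js. \<forall>w. length w = m \<longrightarrow> word_monomial (Word w) \<in> J"
      using that by blast
  qed
  also have "\<dots> \<longleftrightarrow> nilpotent_mat (reduced_adjacency_matrix Is)"
    using A unfolding nilpotent_mat_def reduced_adjacency_matrix_eq Js_def[symmetric] pow[symmetric]
    by auto
  finally show ?thesis .
qed

end
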